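(* Let $\mathcal{S}=\langle\mathcal{L},\vdash\rangle$ be a transitive logic, with $\mathcal{L}$ a formula algebra over a denumerable set of variables $V$. If there is no falsity constant for $\mathcal{S}$ in $\mathcal{L}$, then $\mathcal{S}^{pl}$ is NF-paraconsistent.
   Context: A logic is a pair $\langle\mathcal{L},\vdash\rangle$ with $\vdash\,\subseteq\mathcal{P}(\mathcal{L})\times\mathcal{L}$, and $C_\vdash(\Gamma)=\{\alpha:\Gamma\vdash\alpha\}$. $\mathcal{S}$ is transitive if for all $\Gamma,\Sigma\subseteq\mathcal{L}$, $\Sigma\subseteq C_\vdash(\Gamma)$ implies $C_\vdash(\Sigma)\subseteq C_\vdash(\Gamma)$. $\mathcal{L}$ is the formula algebra over a denumerable set $V$ of variables in a finite signature. $\mathrm{var}(\alpha)$ is the set of variables in $\alpha$; $\mathrm{var}(\Delta)=\bigcup_{\alpha\in\Delta}\mathrm{var}(\alpha)$. A falsity constant is a constant $\bot\in\mathcal{L}$ (with $\mathrm{var}(\bot)=\emptyset$) such that $\{\bot\}\vdash\alpha$ for all $\alpha\in\mathcal{L}$. $\mathcal{S}^{pl}=\langle\mathcal{L},\vdash^{pl}\rangle$ where $\Gamma\vdash^{pl}\alpha$ iff there is a nonempty $\Delta\subseteq\Gamma$ with $\mathrm{var}(\Delta)\subseteq\mathrm{var}(\alpha)$ and $\Delta\vdash\alpha$. A logic is NF-paraconsistent if there exists $\alpha\in\mathcal{L}$ such that $C_\vdash(\{\alpha,\beta\})\neq\mathcal{L}$ for every $\beta\in\mathcal{L}$.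
   Formalization: "Falsity constant" is read as any variable-free formula ⊥ with {⊥}⊢α for all α, not only a nullary connective; with nullary constants only, the claim fails (signature {⊤,¬}, Γ⊢α iff α∈Γ or ¬⊤∈Γ). *)

theory Defs
  imports Main "HOL-Library.Countable_Set"
begin

datatype ('f, 'v) fm = Var 'v | Op 'f "('f, 'v) fm list"

inductive_set formulas :: "'f set \<Rightarrow> ('f \<Rightarrow> nat) \<Rightarrow> 'v set \<Rightarrow> ('f, 'v) fm set"
  for F :: "'f set" and ar :: "'f \<Rightarrow> nat" and V :: "'v set" where
  Var: "x \<in> V \<Longrightarrow> Var x \<in> formulas F ar V"
| Op: "f \<in> F \<Longrightarrow> length ts = ar f \<Longrightarrow> (\<forall>t\<in>set ts. t \<in> formulas F ar V)
    \<Longrightarrow> Op f ts \<in> formulas F ar V"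

fun var :: "('f, 'v) fm \<Rightarrow> 'v set" where
  "var (Var x) = {x}"
| "var (Op f ts) = (\<Union>t\<in>set ts. var t)"

definition var_set :: "('f, 'v) fm set \<Rightarrow> 'v set" where
  "var_set \<Delta> = (\<Union>\<alpha>\<in>\<Delta>. var \<alpha>)"

definition logic :: "'a set \<Rightarrow> ('a set \<times> 'a) set \<Rightarrow> bool" where
  "logic L R \<longleftrightarrow> R \<subseteq> Pow L \<times> L"

definition Cn :: "('a set \<times> 'a) set \<Rightarrow> 'a set \<Rightarrow> 'a set" where
  "Cn R \<Gamma> = {\<alpha>. (\<Gamma>, \<alpha>) \<in> R}"

definition transitive_logic :: "'a set \<Rightarrow> ('a set \<times> 'a) set \<Rightarrow> bool" where
  "transitive_logic L R \<longleftrightarrow> logic L R \<and>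
     (\<forall>\<Gamma> \<Sigma>. \<Gamma> \<subseteq> L \<longrightarrow> \<Sigma> \<subseteq> L \<longrightarrow> \<Sigma> \<subseteq> Cn R \<Gamma> \<longrightarrow> Cn R \<Sigma> \<subseteq> Cn R \<Gamma>)"

text \<open>A constant of \<open>L\<close> is any variable-free formula, not only a nullary connective: an explosive
  compound closed formula already makes every \<open>C({\<alpha>, \<beta>})\<close> of the companion trivial
  for a suitable \<open>\<beta>\<close>.\<close>

definition falsity_constant ::
    "('f, 'v) fm set \<Rightarrow> (('f, 'v) fm set \<times> ('f, 'v) fm) set \<Rightarrow> ('f, 'v) fm \<Rightarrow> bool" where
  "falsity_constant L R b \<longleftrightarrow> b \<in> L \<and> var b = {} \<and> (\<forall>\<alpha>\<in>L. ({b}, \<alpha>) \<in> R)"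

definition pl :: "('f, 'v) fm set \<Rightarrow> (('f, 'v) fm set \<times> ('f, 'v) fm) set
    \<Rightarrow> (('f, 'v) fm set \<times> ('f, 'v) fm) set" where
  "pl L R = {(\<Gamma>, \<alpha>). \<Gamma> \<subseteq> L \<and> \<alpha> \<in> L \<and>
     (\<exists>\<Delta>. \<Delta> \<noteq> {} \<and> \<Delta> \<subseteq> \<Gamma> \<and> var_set \<Delta> \<subseteq> var \<alpha> \<and> (\<Delta>, \<alpha>) \<in> R)}"

definition NF_paraconsistent :: "'a set \<Rightarrow> ('a set \<times> 'a) set \<Rightarrow> bool" where
  "NF_paraconsistent L R \<longleftrightarrow> (\<exists>\<alpha>\<in>L. \<forall>\<beta>\<in>L. Cn R {\<alpha>, \<beta>} \<noteq> L)"

lemma logic_pl: "logic L (pl L R)"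
  by (auto simp: logic_def pl_def)

end

theory Submission imports Defs begin

text \<open>Suppose every \<open>\<alpha>\<close> is exploded in the companion by some \<open>\<beta>\<close>. For \<open>\<alpha>\<close> a variable \<open>x\<close>,
  testing against a fresh variable shows that \<open>\<beta>\<close> is closed and that \<open>{\<beta>}\<close> alone derives every
  formula not containing \<open>x\<close>. The logic need not be structural, so a second variable
  \<open>x'\<close> with its own \<open>\<beta>'\<close> is used to reach \<open>x\<close>: \<open>{\<beta>}\<close> derives the closed formula \<open>\<beta>'\<close>, and \<open>{\<beta>'}\<close>
  derives \<open>x\<close>. By transitivity \<open>{\<beta>}\<close> derives all that subsets of \<open>{x, \<beta>}\<close> do, that is, everything, so
  \<open>\<beta>\<close> is a falsity constant.\<close>

lemma finite_var: "finite (var t)"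
  by (induction t) auto

lemma pl_iff:
  "(\<Gamma>, \<alpha>) \<in> pl L R \<longleftrightarrow> \<Gamma> \<subseteq> L \<and> \<alpha> \<in> L \<and>
     (\<exists>\<Delta>. \<Delta> \<noteq> {} \<and> \<Delta> \<subseteq> \<Gamma> \<and> var_set \<Delta> \<subseteq> var \<alpha> \<and> (\<Delta>, \<alpha>) \<in> R)"
  by (simp add: pl_def)

text \<open>The witness \<open>\<Delta>\<close> may use only variables of \<open>\<gamma>\<close>,
  so it omits \<open>Var x\<close>; being nonempty, it is \<open>{\<beta>}\<close>.\<close>

lemma pl_Var_pairD:
  assumes "({Var x, \<beta>}, \<gamma>) \<in> pl L R" and "x \<notin> var \<gamma>"
  shows "var \<beta> \<subseteq> var \<gamma>" and "({\<beta>}, \<gamma>) \<in> R"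
proof -
  obtain \<Delta> where \<Delta>: "\<Delta> \<noteq> {}" "\<Delta> \<subseteq> {Var x, \<beta>}" "var_set \<Delta> \<subseteq> var \<gamma>" "(\<Delta>, \<gamma>) \<in> R"
    using assms(1) unfolding pl_iff by blast
  have "Var x \<notin> \<Delta>"
    using \<Delta>(3) assms(2) by (force simp: var_set_def)
  then have "\<Delta> = {\<beta>}"
    using \<Delta>(1,2) by blast
  then show "var \<beta> \<subseteq> var \<gamma>" "({\<beta>}, \<gamma>) \<in> R"
    using \<Delta>(3,4) by (auto simp: var_set_def)
qed

lemma pl_Var_explosive_closed:
  assumes "infinite V" and "\<And>y. y \<in> V \<Longrightarrow> Var y \<in> L"
    and "Cn (pl L R) {Var x, \<beta>} = L"
  shows "var \<beta> = {}"
proof -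
  obtain y where y: "y \<in> V" "y \<notin> insert x (var \<beta>)"
    using assms(1) finite_var[of \<beta>] by (meson finite_insert finite_subset subsetI)
  then have "({Var x, \<beta>}, Var y) \<in> pl L R"
    using assms(2,3) by (auto simp: Cn_def)
  \<comment> \<open>\<open>var \<beta>\<close> lies within \<open>{y}\<close> but misses
    \<open>y\<close>.\<close>
  with y show ?thesis
    using pl_Var_pairD(1)[of x \<beta> "Var y"] by auto
qed

theorem theorem2p20:
  fixes F :: "'f set" and ar :: "'f \<Rightarrow> nat" and V :: "'v set"
    and L :: "('f, 'v) fm set" and R :: "(('f, 'v) fm set \<times> ('f, 'v) fm) set"
  assumes "finite F" and "countable V" and "infinite V"
    and "L = formulas F ar V"
    and "transitive_logic L R"
    and "\<not> (\<exists>b. falsity_constant L R b)"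
  shows "NF_paraconsistent L (pl L R)"
proof (rule ccontr)
  assume "\<not> NF_paraconsistent L (pl L R)"
  then have expl: "\<exists>\<beta>\<in>L. Cn (pl L R) {\<alpha>, \<beta>} = L" if "\<alpha> \<in> L" for \<alpha>
    using that by (auto simp: NF_paraconsistent_def)
  have VarL: "Var y \<in> L" if "y \<in> V" for y
    using that assms(4) by (simp add: formulas.Var)
  have trans: "(\<Gamma>, \<gamma>) \<in> R"
    if "\<Gamma> \<subseteq> L" "\<Sigma> \<subseteq> L" "\<forall>\<sigma>\<in>\<Sigma>. (\<Gamma>, \<sigma>) \<in> R" "(\<Sigma>, \<gamma>) \<in> R" for \<Gamma> \<Sigma> \<gamma>
    using assms(5) that unfolding transitive_logic_def Cn_def by blast
  obtain x where x: "x \<in> V"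
    using assms(3) by fastforce
  obtain x' where x': "x' \<in> V" "x' \<noteq> x"
    using assms(3) by (metis finite.emptyI finite_insert finite_subset singletonI subsetI)
  obtain b where b: "b \<in> L" "Cn (pl L R) {Var x, b} = L"
    using expl VarL x by blast
  obtain b' where b': "b' \<in> L" "Cn (pl L R) {Var x', b'} = L"
    using expl VarL x' by blast
  have closed: "var b = {}" "var b' = {}"
    using pl_Var_explosive_closed[OF assms(3) VarL] b(2) b'(2) by blast+
  have b_pl: "({Var x, b}, \<gamma>) \<in> pl L R" and b'_pl: "({Var x', b'}, \<gamma>) \<in> pl L R"
    if "\<gamma> \<in> L" for \<gamma>
    using that b(2) b'(2) by (auto simp: Cn_def)
  \<comment> \<open>Reflexivity of \<open>R\<close> is not assumed, so even
    \<open>({b}, b) \<in> R\<close> is drawn from explosion: \<open>b\<close> and \<open>b'\<close>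
    are closed, hence free of \<open>x\<close>.\<close>
  have bb: "({b}, b) \<in> R" and bb': "({b}, b') \<in> R"
    using pl_Var_pairD(2)[OF b_pl] b(1) b'(1) closed by auto
  have "({b'}, Var x) \<in> R"
    using pl_Var_pairD(2)[OF b'_pl[OF VarL[OF x]]] x' by simp
  then have bx: "({b}, Var x) \<in> R"
    using trans[of "{b}" "{b'}"] bb' b(1) b'(1) by simp
  have "({b}, \<gamma>) \<in> R" if "\<gamma> \<in> L" for \<gamma>
  proof -
    \<comment> \<open>\<open>\<Delta>\<close> may contain \<open>Var x\<close>, which
      \<open>bx\<close> covers.\<close>
    obtain \<Delta> where "\<Delta> \<subseteq> {Var x, b}" "(\<Delta>, \<gamma>) \<in> R"
      using b_pl[OF \<open>\<gamma> \<in> L\<close>] unfolding pl_iff by blast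
    then show ?thesis
      using trans[of "{b}" \<Delta> \<gamma>] bb bx b(1) VarL[OF x] by blast
  qed
  then have "falsity_constant L R b"
    using b(1) closed(1) by (simp add: falsity_constant_def)
  with assms(6) show False by blast
qed

end
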